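(* Let $\mathbb{K}$ be a field, let $n\geq 1$ and $p\geq 2$ be integers, and let $\mathcal{S}$ be a linear subspace of $\mathrm{M}_{n,p}(\mathbb{K})$ with $\operatorname{codim}_{\mathrm{M}_{n,p}(\mathbb{K})}\mathcal{S}\leq d_n(\mathbb{K})$. Then every range-compatible linear map $F:\mathcal{S}\to\mathbb{K}^n$ is local, i.e. there exists $X\in\mathbb{K}^p$ such that $F(M)=MX$ for all $M\in\mathcal{S}$.
   Context: $\mathrm{M}_{n,p}(\mathbb{K})$ denotes the space of $n\times p$ matrices over the field $\mathbb{K}$. We set $d_n(\mathbb{K}):=2n-3$ if $\mathbb{K}$ has more than $2$ elements, and $d_n(\mathbb{K}):=2n-4$ if $\mathbb{K}$ has exactly $2$ elements. For a subset $\mathcal{S}$ of $\mathrm{M}_{n,p}(\mathbb{K})$, a map $F:\mathcal{S}\to\mathbb{K}^n$ is range-compatible when $F(M)\in\operatorname{im}M$ (the column space of $M$) for all $M\in\mathcal{S}$; it is local when there is $X\in\mathbb{K}^p$ with $F(M)=MX$ for all $M\in\mathcal{S}$. *)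

theory Defs
  imports "HOL-Analysis.Analysis"
begin

text \<open>Matrices in M_{n,p}(K) are represented as elements of type 'a^'p^'n
  (n rows indexed by 'n, p columns indexed by 'p); K^n is 'a^'n.
  Scalar multiplication on matrices (entrywise):\<close>

definition mat_scale :: "'a::field \<Rightarrow> 'a^'p^'n \<Rightarrow> 'a^'p^'n" where
  "mat_scale c M = (\<chi> i j. c * M $ i $ j)"

lemma vector_space_mat_scale: "vector_space (mat_scale :: 'a::field \<Rightarrow> 'a^'p^'n \<Rightarrow> 'a^'p^'n)"
  by unfold_locales (simp_all add: mat_scale_def vec_eq_iff algebra_simps)

definition mat_codim :: "('a::field^'p^'n) set \<Rightarrow> int" where
  "mat_codim S = int (vector_space.dim (mat_scale :: 'a \<Rightarrow> 'a^'p^'n \<Rightarrow> 'a^'p^'n) UNIV)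
                 - int (vector_space.dim (mat_scale :: 'a \<Rightarrow> 'a^'p^'n \<Rightarrow> 'a^'p^'n) S)"

definition d_bound :: "nat \<Rightarrow> 'a::field itself \<Rightarrow> int" where
  "d_bound n K = (if CARD('a) = 2 then 2 * int n - 4 else 2 * int n - 3)"

definition linear_on_mat :: "('a::field^'p^'n) set \<Rightarrow> ('a^'p^'n \<Rightarrow> 'a^'n) \<Rightarrow> bool" where
  "linear_on_mat S F \<longleftrightarrow>
     (\<forall>M\<in>S. \<forall>N\<in>S. F (M + N) = F M + F N) \<and>
     (\<forall>c. \<forall>M\<in>S. F (mat_scale c M) = c *s F M)"

definition range_compatible :: "('a::field^'p^'n) set \<Rightarrow> ('a^'p^'n \<Rightarrow> 'a^'n) \<Rightarrow> bool" where
  "range_compatible S F \<longleftrightarrow> (\<forall>M\<in>S. F M \<in> range (\<lambda>X. M *v X))"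

definition local_map :: "('a::field^'p^'n) set \<Rightarrow> ('a^'p^'n \<Rightarrow> 'a^'n) \<Rightarrow> bool" where
  "local_map S F \<longleftrightarrow> (\<exists>X. \<forall>M\<in>S. F M = M *v X)"

end

theory Submission
  imports Defs
begin

text \<open>Write \<open>T\<close> for the orthogonal of \<open>S\<close> with respect to the trace pairing, so that \<open>dim T = codim S\<close>.
  A linear map \<open>F\<close> is range-compatible iff for every functional \<open>f\<close> on \<open>K\<^sup>n\<close> there is a vector \<open>x f\<close> with
  \<open>f (F s) = f (s (x f))\<close> on \<open>S\<close>; then \<open>f \<mapsto> f \<otimes> x f\<close> is linear modulo \<open>T\<close>, and \<open>F\<close> is local
  iff \<open>x\<close> can be chosen constant. For fixed \<open>w\<close> the functionals \<open>f\<close> with \<open>f \<otimes> (x f - w) \<in> T\<close> form a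
  subspace \<open>N\<^sub>w\<close>, and one must show that some \<open>N\<^sub>w\<close> is everything.

  Argue by induction on \<open>n\<close>. If \<open>T a\<close> has dimension at least 2, the induction hypothesis applies
  to the quotient by \<open>a\<close> and gives \<open>w\<close> such that \<open>N\<^sub>w\<close> contains the hyperplane \<open>a\<^sup>\<bottom>\<close>. Two independent vectors
  of this kind give two hyperplanes; if \<open>F\<close> is not local, counting dimensions shows that \<open>T\<close> is too large.
  If \<open>a\<close> is the only such vector up to scaling, all other \<open>T b\<close> are contained in lines, which
  forces all \<open>x f\<close> with \<open>f a \<noteq> 0\<close> to be parallel, and then constant modulo \<open>T\<close>. If all \<open>T b\<close> are
  contained in lines, then either \<open>dim T \<le> 1\<close> or all elements of \<open>T\<close> have their range in one line, and
  the same two parallelism arguments apply.\<close>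

section \<open>Rank-one tensors and contraction with a vector\<close>

definition dot :: "'a::field^'n \<Rightarrow> 'a^'n \<Rightarrow> 'a" where
  "dot f b = (\<Sum>i\<in>UNIV. f $ i * b $ i)"

definition tens :: "'a::field^'n \<Rightarrow> 'a^'p \<Rightarrow> 'a^'p^'n" where
  "tens f u = (\<chi> i j. f $ i * u $ j)"

text \<open>The tensor \<open>t\<close> contracted with \<open>b\<close> in its first factor;
  \<open>T b\<close> in the overview collects these vectors over \<open>t \<in> T\<close>.\<close>

definition act :: "'a::field^'p^'n \<Rightarrow> 'a^'n \<Rightarrow> 'a^'p" where
  "act t b = (\<chi> j. \<Sum>i\<in>UNIV. t $ i $ j * b $ i)"

lemma dot_simps [simp]:
  "dot (f + g) b = dot f b + dot g b"
  "dot (f - g) b = dot f b - dot g b"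
  "dot (c *s f) b = c * dot f b"
  "dot f (b + b') = dot f b + dot f b'"
  "dot f (b - b') = dot f b - dot f b'"
  "dot f (c *s b) = c * dot f b"
  "dot 0 b = 0" "dot f 0 = 0"
  unfolding dot_def
  by (simp_all add: algebra_simps sum.distrib sum_distrib_left sum_subtractf)

lemma tens_simps:
  "tens (f + g) u = tens f u + tens g u"
  "tens (f - g) u = tens f u - tens g u"
  "tens (c *s f) u = mat_scale c (tens f u)"
  "tens f (u + v) = tens f u + tens f v"
  "tens f (u - v) = tens f u - tens f v"
  "tens f (c *s u) = mat_scale c (tens f u)"
  "tens 0 u = 0" "tens f 0 = 0"
  unfolding tens_def mat_scale_def by (simp_all add: vec_eq_iff algebra_simps)

lemma act_simps [simp]:
  "act (t + t') b = act t b + act t' b"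
  "act (t - t') b = act t b - act t' b"
  "act (mat_scale c t) b = c *s act t b"
  "act t (b + b') = act t b + act t b'"
  "act t (b - b') = act t b - act t b'"
  "act t (c *s b) = c *s act t b"
  "act 0 b = 0" "act t 0 = 0"
  "act (tens f u) b = dot f b *s u"
  unfolding act_def tens_def dot_def mat_scale_def
  by (simp_all add: vec_eq_iff algebra_simps sum.distrib sum_distrib_left sum_subtractf)

lemma act_axis: "act t (axis i 1) = t $ i"
  by (simp add: act_def vec_eq_iff axis_def if_distrib[where f="\<lambda>x. _ * x"] cong: if_cong)

lemma act_eq_0D: "(\<And>b. act t b = 0) \<Longrightarrow> t = 0"
  by (metis act_axis vec_eq_iff zero_index)

section \<open>Finite dimension of the matrix space\<close>

definition mat_unit :: "'n \<times> 'p \<Rightarrow> 'a::field^'p^'n" where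
  "mat_unit = (\<lambda>(i, j). tens (axis i 1) (axis j 1))"

interpretation mat: vector_space "mat_scale :: 'a::field \<Rightarrow> 'a^'p^'n \<Rightarrow> 'a^'p^'n"
  by (rule vector_space_mat_scale)

lemma span_mat_unit: "mat.span (range mat_unit) = (UNIV :: ('a::field^'p^'n) set)"
proof -
  have "M \<in> mat.span (range mat_unit)" for M :: "'a^'p^'n"
  proof -
    have "M = (\<Sum>i\<in>UNIV. \<Sum>j\<in>UNIV. mat_scale (M $ i $ j) (mat_unit (i, j)))"
      by (simp add: vec_eq_iff mat_scale_def mat_unit_def tens_def axis_def
          if_distrib[where f="\<lambda>x. _ * x"] if_distrib[where f="\<lambda>x. x * _"] cong: if_cong)
    also have "\<dots> \<in> mat.span (range mat_unit)"
      by (intro mat.span_sum mat.span_scale mat.span_base) auto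
    finally show ?thesis .
  qed
  then show ?thesis by auto
qed

definition mat_basis :: "('a::field^'p^'n) set" where
  "mat_basis = (SOME B. B \<subseteq> range mat_unit \<and> mat.independent B \<and> range mat_unit \<subseteq> mat.span B)"

lemma mat_basis:
  fixes B :: "('a::field^'p^'n) set"
  defines "B \<equiv> mat_basis"
  shows "B \<subseteq> range mat_unit" "mat.independent B" "range mat_unit \<subseteq> mat.span B"
proof -
  have "\<exists>B. B \<subseteq> range mat_unit \<and> mat.independent B \<and> range mat_unit \<subseteq> mat.span (B :: ('a::field^'p^'n) set)"
    by (meson mat.maximal_independent_subset)
  then have "B \<subseteq> range mat_unit \<and> mat.independent B \<and> range mat_unit \<subseteq> mat.span B"
    unfolding B_def mat_basis_def by (rule someI_ex)
  then show "B \<subseteq> range mat_unit" "mat.independent B" "range mat_unit \<subseteq> mat.span B"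
    by auto
qed

interpretation mat: finite_dimensional_vector_space
  "mat_scale :: 'a::field \<Rightarrow> 'a^'p^'n \<Rightarrow> 'a^'p^'n" mat_basis
proof
  show "finite (mat_basis :: ('a^'p^'n) set)"
    by (rule finite_subset[OF mat_basis(1)]) simp
  show "mat.independent (mat_basis :: ('a^'p^'n) set)" by (rule mat_basis)
  have "mat.span (range mat_unit) \<subseteq> mat.span (mat_basis :: ('a^'p^'n) set)"
    by (rule mat.span_minimal[OF mat_basis(3)]) simp
  then show "mat.span mat_basis = (UNIV :: ('a^'p^'n) set)"
    by (auto simp: span_mat_unit)
qed

section \<open>Separation from a subspace, and a dimension count\<close>

lemma dot_separation:
  fixes f :: "'a::field^'n"
  assumes "f \<notin> vec.span B"
  obtains c where "\<And>g. g \<in> vec.span B \<Longrightarrow> dot g c = 0" "dot f c = 1"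
proof -
  obtain B0 where B0: "B0 \<subseteq> B" "vec.independent B0" "B \<subseteq> vec.span B0"
    by (rule vec.maximal_independent_subset)
  then have sp: "vec.span B = vec.span B0"
    by (metis vec.span_mono vec.span_span subset_antisym)
  have ind: "vec.independent (insert f B0)"
    using assms B0 sp by (simp add: vec.independent_insertI)
  obtain h :: "'a^'n \<Rightarrow> 'a^'n" where h: "Vector_Spaces.linear (*s) (*s) h"
    "\<forall>x\<in>insert f B0. h x = (if x = f then 1 else 0)"
    using vec.linear_independent_extend[OF ind, of "\<lambda>x. if x = f then 1 else 0"] by blast
  interpret h: Vector_Spaces.linear "(*s)" "(*s)" h by (rule h(1))
  \<comment> \<open>\<open>h f\<close> is the all-ones vector, so any single coordinate of
    \<open>h\<close> is a functional with value 1 at \<open>f\<close>.\<close>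
  fix k :: 'n
  define c where "c = (\<chi> i. h (axis i 1) $ k)"
  have hc: "h v $ k = dot v c" for v
  proof -
    have "v = (\<Sum>i\<in>UNIV. v $ i *s axis i 1)"
      by (rule basis_expansion[symmetric])
    then have "h v = (\<Sum>i\<in>UNIV. v $ i *s h (axis i 1))"
      by (metis (mono_tags, lifting) h.scale h.sum sum.cong)
    then show ?thesis by (simp add: c_def dot_def)
  qed
  have "h g = 0" if "g \<in> vec.span B" for g
    using that unfolding sp
    by (induction rule: vec.span_induct_alt)
      (use h(2) assms sp vec.span_base h.zero h.add h.scale in \<open>auto split: if_splits\<close>)
  then have 1: "dot g c = 0" if "g \<in> vec.span B" for g using that by (simp flip: hc)
  have 2: "dot f c = 1" using h(2) by (simp flip: hc)
  show ?thesis by (rule that[OF 1 2])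
qed

interpretation vec_mat: finite_dimensional_vector_space_pair
  "(*s) :: 'a::field \<Rightarrow> 'a^'n \<Rightarrow> 'a^'n" cart_basis "mat_scale :: 'a \<Rightarrow> 'a^'p^'n \<Rightarrow> 'a^'p^'n" mat_basis
  by unfold_locales

text \<open>Filter \<open>T\<close> along a basis of \<open>Q\<close>: \<open>Z B\<close> consists
  of the tensors sending the common kernel of \<open>B\<close> into the line of \<open>z\<close>.
  \<open>Z {}\<close> contains all \<open>tens g z\<close> with \<open>g \<in> D\<close>, and each
  new \<open>f\<close> contributes a tensor outside the previous stage.\<close>

lemma dim_add_dim_le:
  fixes T :: "('a::field^'p^'n) set"
  assumes T: "mat.subspace T" and D: "vec.subspace D" "\<And>g. g \<in> D \<Longrightarrow> tens g z \<in> T"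
    and Q: "\<And>f. f \<in> Q \<Longrightarrow> \<exists>u L. (\<forall>c. u \<noteq> c *s z) \<and> tens f u + tens L z \<in> T"
    and z: "z \<noteq> 0"
  shows "vec.dim D + vec.dim Q \<le> mat.dim T"
proof -
  obtain B where B: "B \<subseteq> Q" "vec.independent B" "card B = vec.dim Q"
    using vec.basis_exists by metis
  have "finite B" using B(2) by (rule vec.finiteI_independent)
  define Z where "Z B = {t \<in> T. \<forall>v. (\<forall>f\<in>B. dot f v = 0) \<longrightarrow> (\<exists>c. act t v = c *s z)}" for B
  have Z_sub: "mat.subspace (Z B)" for B
    unfolding mat.subspace_def
  proof (intro conjI ballI allI)
    show "0 \<in> Z B"
      using mat.subspace_0[OF T] by (auto simp: Z_def intro: exI[of _ 0])
    show "s + t \<in> Z B" if "s \<in> Z B" "t \<in> Z B" for s t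
    proof -
      have "\<exists>c. act (s + t) v = c *s z" if v: "\<forall>f\<in>B. dot f v = 0" for v
      proof -
        obtain c d where "act s v = c *s z" "act t v = d *s z"
          using \<open>s \<in> Z B\<close> \<open>t \<in> Z B\<close> v unfolding Z_def by blast
        then have "act (s + t) v = (c + d) *s z" by (simp add: vec.scale_left_distrib)
        then show ?thesis ..
      qed
      then show ?thesis using that mat.subspace_add[OF T] by (auto simp: Z_def)
    qed
    show "mat_scale k t \<in> Z B" if t: "t \<in> Z B" for k t
    proof -
      have "\<exists>c. act (mat_scale k t) v = c *s z" if v: "\<forall>f\<in>B. dot f v = 0" for v
      proof -
        obtain c where "act t v = c *s z" using t v by (auto simp: Z_def)
        then have "act (mat_scale k t) v = (k * c) *s z" by simp
        then show ?thesis ..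
      qed
      then show ?thesis using t mat.subspace_scale[OF T] by (auto simp: Z_def)
    qed
  qed
  have "vec.dim D + card B \<le> mat.dim (Z B)"
    using \<open>finite B\<close> B(1,2)
  proof (induction B)
    case empty
    have lin: "Vector_Spaces.linear (*s) mat_scale (\<lambda>g. tens g z)"
      by unfold_locales (simp_all add: tens_simps)
    have inj: "inj_on (\<lambda>g. tens g z) (vec.span D)"
    proof (rule inj_onI)
      fix g h assume eq: "tens g z = tens h z"
      obtain j where "z $ j \<noteq> 0" using z by (auto simp: vec_eq_iff)
      moreover have "g $ i * z $ j = h $ i * z $ j" for i
        using arg_cong[OF eq, of "\<lambda>M. M $ i $ j"] by (simp add: tens_def del: mult_cancel_right)
      ultimately show "g = h" by (metis mult_right_cancel vec_eq_iff)
    qed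
    have "(\<lambda>g. tens g z) ` D \<subseteq> Z {}"
      using D by (auto simp: Z_def)
    then have "mat.dim ((\<lambda>g. tens g z) ` D) \<le> mat.dim (Z {})"
      by (rule mat.dim_subset)
    then show ?case
      using vec_mat.dim_image_eq[OF lin inj] by simp
  next
    case (insert f B)
    obtain u L where uL: "\<forall>c. u \<noteq> c *s z" "tens f u + tens L z \<in> T"
      using Q insert.prems(1) by blast
    let ?t = "tens f u + tens L z"
    have "f \<notin> vec.span B"
      using insert.prems(2) insert.hyps by (simp add: vec.independent_insert)
    then obtain c where c: "\<And>g. g \<in> vec.span B \<Longrightarrow> dot g c = 0" "dot f c = 1"
      by (rule dot_separation) blast
    \<comment> \<open>At \<open>c\<close>, the tensor takes the value \<open>u\<close> plus a
      multiple of \<open>z\<close>, which is off the line of \<open>z\<close>, although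
      \<open>B\<close> kills \<open>c\<close>.\<close>
    have "?t \<notin> Z B"
    proof
      assume "?t \<in> Z B"
      moreover have "\<forall>f\<in>B. dot f c = 0" using c by (simp add: vec.span_base)
      ultimately obtain k where "act ?t c = k *s z" unfolding Z_def by blast
      then have "u + dot L c *s z = k *s z" using c by simp
      then have "u = (k - dot L c) *s z"
        by (simp add: vec.scale_left_diff_distrib eq_diff_eq)
      then show False using uL(1) by blast
    qed
    then have "mat.dim (insert ?t (Z B)) = mat.dim (Z B) + 1"
      using mat.span_eq_iff[THEN iffD2, OF Z_sub] by (simp add: mat.dim_insert del: mat.span_eq_iff)
    moreover have "insert ?t (Z B) \<subseteq> Z (insert f B)"
      using uL(2) by (auto simp: Z_def)
    then have "mat.dim (insert ?t (Z B)) \<le> mat.dim (Z (insert f B))"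
      by (rule mat.dim_subset)
    ultimately show ?case
      using insert.IH insert.prems insert.hyps by (auto simp: vec.independent_insert)
  qed
  also have "mat.dim (Z B) \<le> mat.dim T"
    by (rule mat.dim_subset) (auto simp: Z_def)
  finally show ?thesis using B(3) by simp
qed

lemma scale_cancel:
  assumes "vec.subspace V" "c *s f \<in> V" "c \<noteq> 0" shows "f \<in> V"
  using vec.subspace_scale[OF assms(1,2), of "inverse c"] assms(3) by simp

subsection \<open>Families compatible modulo a matrix space\<close>

text \<open>The functionals \<open>\<Phi>\<close> stand for the dual of a quotient of \<open>K\<^sup>n\<close>, and \<open>T\<close> for the orthogonal of the
  image of \<open>S\<close> in that quotient. The assumptions say that \<open>f \<mapsto> f \<otimes> x f\<close> is linear modulo \<open>T\<close> and
  that \<open>T \<subseteq> \<Phi> \<otimes> K\<^sup>p\<close>.\<close>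

locale rc_family =
  fixes \<Phi> :: "('a::field^'n) set" and T :: "('a^'p^'n) set" and x :: "'a^'n \<Rightarrow> 'a^'p"
  assumes subspace_\<Phi>: "vec.subspace \<Phi>" and subspace_T: "mat.subspace T"
    and add: "\<lbrakk>f \<in> \<Phi>; g \<in> \<Phi>\<rbrakk> \<Longrightarrow> tens (f + g) (x (f + g)) - tens f (x f) - tens g (x g) \<in> T"
    and scale: "f \<in> \<Phi> \<Longrightarrow> tens (c *s f) (x (c *s f)) - mat_scale c (tens f (x f)) \<in> T"
    and supp: "\<lbrakk>t \<in> T; \<And>f. f \<in> \<Phi> \<Longrightarrow> dot f b = 0\<rbrakk> \<Longrightarrow> act t b = 0"
begin

text \<open>This is \<open>N\<^sub>w\<close> of the overview; locality means that one such space is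
  all of \<open>\<Phi>\<close>.\<close>

definition agree :: "'a^'p \<Rightarrow> ('a^'n) set" where
  "agree w = {f \<in> \<Phi>. tens f (x f - w) \<in> T}"

text \<open>The functionals \<open>f\<close> for which \<open>x f\<close> may be moved along
  \<open>z\<close> without changing \<open>tens f (x f)\<close> modulo \<open>T\<close>.\<close>

definition fac :: "'a^'p \<Rightarrow> ('a^'n) set" where
  "fac z = {f \<in> \<Phi>. tens f z \<in> T}"

lemmas \<Phi>_closed = vec.subspace_add[OF subspace_\<Phi>] vec.subspace_diff[OF subspace_\<Phi>]
  vec.subspace_scale[OF subspace_\<Phi>] vec.subspace_0[OF subspace_\<Phi>]
lemmas T_closed = mat.subspace_add[OF subspace_T] mat.subspace_diff[OF subspace_T]
  mat.subspace_scale[OF subspace_T] mat.subspace_0[OF subspace_T]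

lemma lincomb:
  assumes "f \<in> \<Phi>" "g \<in> \<Phi>"
  shows "tens (a *s f + b *s g) (x (a *s f + b *s g))
    - mat_scale a (tens f (x f)) - mat_scale b (tens g (x g)) \<in> T" (is "?l \<in> T")
proof -
  let ?p = "a *s f" and ?q = "b *s g"
  have "?l = (tens (?p + ?q) (x (?p + ?q)) - tens ?p (x ?p) - tens ?q (x ?q))
     + (tens ?p (x ?p) - mat_scale a (tens f (x f))) + (tens ?q (x ?q) - mat_scale b (tens g (x g)))"
    by simp
  also have "\<dots> \<in> T"
    using assms by (intro T_closed add scale \<Phi>_closed)
  finally show ?thesis .
qed

text \<open>Combining the three memberships, the terms in \<open>x\<close> cancel modulo
  \<open>T\<close> by linearity and only multiples of \<open>z\<close> remain.\<close>

lemma fac_lincomb: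
  assumes "f \<in> agree (k *s z)" "g \<in> agree (l *s z)" "a *s f + b *s g \<in> agree (m *s z)"
  shows "(a * (k - m)) *s f + (b * (l - m)) *s g \<in> fac z"
proof -
  let ?h = "a *s f + b *s g"
  have "tens ((a * (k - m)) *s f + (b * (l - m)) *s g) z =
      tens ?h (x ?h - m *s z) - mat_scale a (tens f (x f - k *s z)) - mat_scale b (tens g (x g - l *s z))
      - (tens ?h (x ?h) - mat_scale a (tens f (x f)) - mat_scale b (tens g (x g)))"
    by (simp add: vec_eq_iff tens_def mat_scale_def algebra_simps)
  also have "\<dots> \<in> T"
    using assms by (intro T_closed lincomb) (auto simp: agree_def)
  finally show ?thesis
    using assms by (auto simp: fac_def agree_def intro!: \<Phi>_closed)
qed

lemma subspace_agree: "vec.subspace (agree w)"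
proof -
  have "a *s f + b *s g \<in> agree w" if fg: "f \<in> agree w" "g \<in> agree w" for f g a b
  proof -
    let ?h = "a *s f + b *s g"
    have "tens ?h (x ?h - w) = mat_scale a (tens f (x f - w)) + mat_scale b (tens g (x g - w))
      + (tens ?h (x ?h) - mat_scale a (tens f (x f)) - mat_scale b (tens g (x g)))"
      by (simp add: vec_eq_iff tens_def mat_scale_def algebra_simps)
    also have "\<dots> \<in> T"
      using fg by (intro T_closed lincomb) (auto simp: agree_def)
    finally show ?thesis
      using fg by (auto simp: agree_def intro!: \<Phi>_closed)
  qed
  from this[of _ _ 1 1] this[where b = 0] show ?thesis
    using T_closed(4) \<Phi>_closed(4) by (auto simp: vec.subspace_def agree_def tens_simps)
qed

lemma subspace_fac: "vec.subspace (fac z)"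
  by (auto simp: vec.subspace_def fac_def tens_simps intro!: \<Phi>_closed T_closed)

lemmas agree_closed = vec.subspace_add[OF subspace_agree] vec.subspace_diff[OF subspace_agree]
  vec.subspace_scale[OF subspace_agree] vec.subspace_0[OF subspace_agree]
lemmas fac_closed = vec.subspace_add[OF subspace_fac] vec.subspace_diff[OF subspace_fac]
  vec.subspace_scale[OF subspace_fac] vec.subspace_0[OF subspace_fac]

lemma fac_subset: "f \<in> fac w \<Longrightarrow> f \<in> \<Phi>" by (simp add: fac_def)

lemma agree_self: "f \<in> \<Phi> \<Longrightarrow> f \<in> agree (x f)"
  using T_closed(4) by (simp add: agree_def tens_simps)

lemma agree_shift:
  assumes "f \<in> agree w" "f \<in> fac z"
  shows "f \<in> agree (w + c *s z)"
proof -
  have "tens f (x f - (w + c *s z)) = tens f (x f - w) - mat_scale c (tens f z)"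
    by (simp add: vec_eq_iff tens_def mat_scale_def algebra_simps)
  also have "\<dots> \<in> T"
    using assms by (intro T_closed) (auto simp: agree_def fac_def)
  finally show ?thesis using assms by (simp add: agree_def)
qed

lemma agree_shift_line:
  assumes "f \<in> agree (k *s z)" "f \<in> fac z"
  shows "f \<in> agree (l *s z)"
  using agree_shift[OF assms, of "l - k"] by (simp flip: vec.scale_left_distrib)

lemma fac_of_agree2:
  assumes "f \<in> agree (k *s z)" "f \<in> agree (l *s z)" "k \<noteq> l"
  shows "f \<in> fac z"
proof -
  have "(1 * (k - l)) *s f + (0 * (k - l)) *s f \<in> fac z"
    by (rule fac_lincomb) (use assms in auto)
  then have "(k - l) *s f \<in> fac z" by simp
  then show ?thesis
    by (rule scale_cancel[OF subspace_fac]) (use assms(3) in simp)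
qed

text \<open>Only the scalars must be made equal. On \<open>fac z\<close> the scalar is arbitrary;
  one \<open>f\<close> outside \<open>fac z\<close> fixes it, and comparing \<open>f\<close>,
  \<open>g\<close> and \<open>f + g\<close> transfers it to every \<open>g\<close>.\<close>

lemma local_of_covering:
  assumes cover: "\<And>f. f \<in> \<Phi> \<Longrightarrow> \<exists>l. f \<in> agree (l *s z)"
  shows "\<exists>w. \<Phi> \<subseteq> agree w"
proof (cases "\<Phi> \<subseteq> fac z")
  case True
  then have "f \<in> agree (0 *s z)" if "f \<in> \<Phi>" for f
    using cover[OF that] agree_shift_line that by blast
  then show ?thesis by blast
next
  case False
  then obtain f k where f: "f \<in> \<Phi>" "f \<notin> fac z" "f \<in> agree (k *s z)"
    using cover by blast
  have "g \<in> agree (k *s z)" if g: "g \<in> \<Phi>" for g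
  proof -
    obtain l where l: "g \<in> agree (l *s z)" using cover g by blast
    obtain m where m: "f + g \<in> agree (m *s z)" using cover \<Phi>_closed(1) f(1) g by blast
    have "(1 * (k - m)) *s f + (1 * (l - m)) *s g \<in> fac z"
      by (rule fac_lincomb) (use f l m in auto)
    then have d: "(k - m) *s f + (l - m) *s g \<in> fac z" by simp
    show ?thesis
    proof (cases "l = m")
      case True
      then have "(k - m) *s f \<in> fac z" using d by simp
      then have "k = m" using scale_cancel[OF subspace_fac, of "k - m" f] f(2) by (metis eq_iff_diff_eq_0)
      then show ?thesis using l True by simp
    next
      case False
      \<comment> \<open>By the covering, an element of \<open>fac z\<close> agrees with every
        multiple of \<open>z\<close>; removing the part in \<open>f\<close> leaves a nonzero
        multiple of \<open>g\<close>.\<close>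
      have "(k - m) *s f + (l - m) *s g \<in> agree (k *s z)"
        using cover[OF fac_subset[OF d]] agree_shift_line d by blast
      then have "((k - m) *s f + (l - m) *s g) - (k - m) *s f \<in> agree (k *s z)"
        by (rule agree_closed(2)[OF _ agree_closed(3)[OF f(3)]])
      then have "(l - m) *s g \<in> agree (k *s z)"
        by (simp only: add_diff_cancel_left')
      then show ?thesis
        by (rule scale_cancel[OF subspace_agree]) (use False in simp)
    qed
  qed
  then show ?thesis by blast
qed

text \<open>For \<open>f b \<noteq> 0\<close>, the vector \<open>x f\<close> lies in the line \<open>T b\<close>. Two functionals not vanishing at \<open>a\<close> can be
  tested on a common \<open>b\<close>, so all these \<open>x f\<close> are parallel and the covering lemma applies.\<close>

lemma local_of_lines:
  assumes hyp: "\<And>f. f \<in> \<Phi> \<Longrightarrow> dot f a = 0 \<Longrightarrow> f \<in> agree 0"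
    and line: "\<And>b. (\<And>k. \<exists>f\<in>\<Phi>. dot f b \<noteq> k * dot f a) \<Longrightarrow> \<exists>u. \<forall>t\<in>T. \<exists>c. act t b = c *s u"
    and dim: "vec.dim \<Phi> \<ge> 3 \<or> vec.dim \<Phi> \<ge> 2 \<and> (\<exists>k::'a. k \<noteq> 0 \<and> k \<noteq> 1)"
  shows "\<exists>w. \<Phi> \<subseteq> agree w"
proof (cases "\<Phi> \<subseteq> agree 0")
  case False
  then obtain f0 where f0: "f0 \<in> \<Phi>" "f0 \<notin> agree 0" "dot f0 a \<noteq> 0"
    using hyp by blast
  have z: "x f0 \<noteq> 0" using agree_self[OF f0(1)] f0(2) by auto
  have "\<exists>l. x f = l *s x f0" if f: "f \<in> \<Phi>" "dot f a \<noteq> 0" for f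
  proof -
    have "\<exists>b. dot f0 b \<noteq> 0 \<and> dot f b \<noteq> 0 \<and> (\<forall>k. \<exists>f\<in>\<Phi>. dot f b \<noteq> k * dot f a)"
    proof (cases "\<Phi> \<subseteq> vec.span {f0, f}")
      case False
      then obtain g where g: "g \<in> \<Phi>" "g \<notin> vec.span {f0, f}" by blast
      obtain c where c: "\<And>h. h \<in> vec.span {f0, f} \<Longrightarrow> dot h c = 0" "dot g c = 1"
        using dot_separation[OF g(2)] by metis
      have "dot f0 c = 0" "dot f c = 0" using c(1) by (auto simp: vec.span_base)
      moreover have "\<exists>h\<in>\<Phi>. dot h (a + c) \<noteq> k * dot h a" for k
      proof (cases "k = 1")
        case True then show ?thesis using g c by (intro bexI[of _ g]) auto
      next
        case False
        then show ?thesis using f0 \<open>dot f0 c = 0\<close> by (intro bexI[of _ f0]) auto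
      qed
      ultimately show ?thesis using f f0 by (intro exI[of _ "a + c"]) simp
    next
      case True
      then have "vec.dim \<Phi> \<le> vec.dim {f0, f}"
        by (metis vec.dim_span vec.dim_subset)
      also have "\<dots> \<le> 2"
        using vec.dim_insert[of f0 "{f}"] vec.dim_insert[of f "{}"] by simp
      finally obtain k :: 'a where k: "k \<noteq> 0" "k \<noteq> 1" and d2: "vec.dim \<Phi> \<ge> 2"
        using dim by auto
      have "f \<notin> vec.span {f0}"
      proof
        assume "f \<in> vec.span {f0}"
        then have "vec.dim {f, f0} = vec.dim {f0}" by (simp add: vec.dim_insert)
        also have "\<dots> \<le> 1" using vec.dim_insert[of f0 "{}"] by simp
        finally show False
          using \<open>vec.dim \<Phi> \<le> vec.dim {f0, f}\<close> d2 by (simp add: insert_commute)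
      qed
      then obtain c where c: "\<And>h. h \<in> vec.span {f0} \<Longrightarrow> dot h c = 0" "dot f c = 1"
        using dot_separation by metis
      have c0: "dot f0 c = 0" using c(1) by (auto simp: vec.span_base)
      \<comment> \<open>This multiplies the value of \<open>f\<close> by \<open>k\<close> and keeps
        that of \<open>f0\<close>: \<open>k \<noteq> 0\<close> keeps both nonzero, and
        \<open>k \<noteq> 1\<close> prevents proportionality to \<open>a\<close>.\<close>
      let ?b = "a + ((k - 1) * dot f a) *s c"
      have fb: "dot f0 ?b = dot f0 a" "dot f ?b = k * dot f a"
        using c0 c(2) by (auto simp: algebra_simps)
      have "\<exists>h\<in>\<Phi>. dot h ?b \<noteq> m * dot h a" for m
      proof (cases "m = 1")
        case True then show ?thesis using fb k f by (intro bexI[of _ f]) auto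
      next
        case False
        then show ?thesis using f0 fb by (intro bexI[of _ f0]) auto
      qed
      then show ?thesis using fb f f0 k by (intro exI[of _ ?b]) auto
    qed
    then obtain b where b: "dot f0 b \<noteq> 0" "dot f b \<noteq> 0" "\<And>k. \<exists>f\<in>\<Phi>. dot f b \<noteq> k * dot f a"
      by blast
    obtain u where u: "\<And>t. t \<in> T \<Longrightarrow> \<exists>c. act t b = c *s u"
      using line[OF b(3)] by blast
    obtain g where g: "g \<in> \<Phi>" "dot g b \<noteq> dot f0 b / dot f0 a * dot g a"
      using b(3) by blast
    \<comment> \<open>Adding multiples of \<open>g'\<close> can make a functional vanish at
      \<open>a\<close> without changing its value at \<open>b\<close>.\<close>
    define g' where "g' = dot f0 b *s g - dot g b *s f0"
    have g': "g' \<in> \<Phi>" "dot g' b = 0" "dot g' a \<noteq> 0"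
      using g f0 by (auto intro!: \<Phi>_closed simp: g'_def field_simps)
    have xu: "\<exists>c. x h = c *s u" if h: "h \<in> \<Phi>" "dot h b \<noteq> 0" for h
    proof -
      let ?r = "dot h a / dot g' a"
      let ?h = "1 *s h + (- ?r) *s g'"
      have "dot ?h a = 0" using g'(3) by simp
      then have "?h \<in> agree 0"
        using h g' by (intro hyp \<Phi>_closed) auto
      then have "tens ?h (x ?h) \<in> T" by (simp add: agree_def)
      \<comment> \<open>This is \<open>tens h (x h)\<close> minus a multiple of
        \<open>tens g' (x g')\<close>; contraction with \<open>b\<close> kills the second
        term.\<close>
      then have "tens ?h (x ?h) - (tens ?h (x ?h) - mat_scale 1 (tens h (x h)) - mat_scale (- ?r) (tens g' (x g'))) \<in> T"
        using h g' by (intro T_closed lincomb) auto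
      then obtain c where "act (tens ?h (x ?h) - (tens ?h (x ?h) - mat_scale 1 (tens h (x h))
          - mat_scale (- ?r) (tens g' (x g')))) b = c *s u"
        using u by blast
      then have "dot h b *s x h = c *s u"
        by (simp add: g'(2) del: dot_simps)
      then have "x h = (c / dot h b) *s u"
        using h(2) by (metis divide_inverse mult.commute vec.scale_left_imp_eq
            vec.scale_scale left_inverse vec.scale_one)
      then show ?thesis by blast
    qed
    obtain c c' where "x f0 = c *s u" "x f = c' *s u"
      using xu f f0 b by metis
    then have "x f = (c' / c) *s x f0" using z by auto
    then show ?thesis by blast
  qed
  then have "\<exists>l. f \<in> agree (l *s x f0)" if "f \<in> \<Phi>" for f
    using hyp[OF that] agree_self[OF that] that
    by (metis vec.scale_zero_left)
  then show ?thesis by (rule local_of_covering)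
qed auto
end

lemma dim_le_of_subset_span: "S \<subseteq> vec.span Q \<Longrightarrow> vec.dim S \<le> vec.dim Q"
  by (metis vec.dim_span vec.dim_subset)

text \<open>Infinite fields are included, since \<open>CARD\<close> is 0 for an infinite
  type.\<close>

lemma exists_scalar_not_0_1:
  assumes "CARD('a::field) \<noteq> 2"
  shows "\<exists>k::'a. k \<noteq> 0 \<and> k \<noteq> 1"
proof (rule ccontr)
  assume "\<not> ?thesis"
  then have "(UNIV :: 'a set) = {0, 1}" by blast
  then have "CARD('a) = card {0::'a, 1}" by simp
  then show False using assms by simp
qed

context rc_family begin

text \<open>If the family is not local, then \<open>T\<close> is too large: it contains all \<open>f \<otimes> z\<close> with
  \<open>f\<close> vanishing at \<open>a\<close> and \<open>b\<close>, and, independently of these, one element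
  \<open>f \<otimes> x f - f(a) q \<otimes> z\<close> for each \<open>f\<close> in a basis made of functionals with \<open>x f \<notin> K z\<close>.\<close>

lemma local_of_two_hyperplanes:
  assumes hyp_a: "\<And>f. f \<in> \<Phi> \<Longrightarrow> dot f a = 0 \<Longrightarrow> f \<in> agree 0"
    and hyp_b: "\<And>f. f \<in> \<Phi> \<Longrightarrow> dot f b = 0 \<Longrightarrow> f \<in> agree z"
    and p: "p \<in> \<Phi>" "dot p a = 0" "dot p b = 1"
    and q: "q \<in> \<Phi>" "dot q a = 1" "dot q b = 0"
    and dim: "int (mat.dim T) \<le> d_bound (vec.dim \<Phi>) TYPE('a)"
  shows "\<exists>w. \<Phi> \<subseteq> agree w"
proof (rule ccontr)
  assume nonlocal: "\<not> ?thesis"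
  define M where "M = {f \<in> \<Phi>. dot f a = 0 \<and> dot f b = 0}"
  have M_sub: "vec.subspace M"
    by (auto simp: vec.subspace_def M_def intro!: \<Phi>_closed)
  have decomp: "f - dot f b *s p - dot f a *s q \<in> M" if "f \<in> \<Phi>" for f
    using that p q by (auto simp: M_def intro!: \<Phi>_closed)
  have "p \<in> agree 0" "q \<in> agree z" using hyp_a hyp_b p q by auto
  have pz: "p \<notin> agree z"
  proof
    assume "p \<in> agree z"
    have "f \<in> agree z" if "f \<in> \<Phi>" for f
    proof -
      have "(f - dot f b *s p) + dot f b *s p \<in> agree z"
        by (rule agree_closed(1)[OF hyp_b agree_closed(3)])
          (use that p \<open>p \<in> agree z\<close> in \<open>auto intro!: \<Phi>_closed\<close>)
      then show ?thesis by simp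
    qed
    then show False using nonlocal by blast
  qed
  have q0: "q \<notin> agree 0"
  proof
    assume "q \<in> agree 0"
    have "f \<in> agree 0" if "f \<in> \<Phi>" for f
    proof -
      have "(f - dot f a *s q) + dot f a *s q \<in> agree 0"
        by (rule agree_closed(1)[OF hyp_a agree_closed(3)])
          (use that q \<open>q \<in> agree 0\<close> in \<open>auto intro!: \<Phi>_closed\<close>)
      then show ?thesis by simp
    qed
    then show False using nonlocal by blast
  qed
  have z: "z \<noteq> 0" using pz \<open>p \<in> agree 0\<close> by auto
  have M_fac: "M \<subseteq> fac z"
  proof
    fix f assume "f \<in> M"
    then show "f \<in> fac z"
      using fac_of_agree2[of f 0 z 1] hyp_a hyp_b by (auto simp: M_def)
  qed
  have dim_\<Phi>: "vec.dim \<Phi> \<le> vec.dim M + 2"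
  proof -
    have "f \<in> vec.span (insert p (insert q M))" if "f \<in> \<Phi>" for f
    proof -
      have "f - dot f b *s p - dot f a *s q \<in> vec.span (insert p (insert q M))"
        "p \<in> vec.span (insert p (insert q M))" "q \<in> vec.span (insert p (insert q M))"
        using decomp[OF that] by (auto intro: vec.span_base)
      then have "(f - dot f b *s p - dot f a *s q) + dot f b *s p + dot f a *s q
          \<in> vec.span (insert p (insert q M))"
        by (rule vec.span_add[OF vec.span_add[OF _ vec.span_scale] vec.span_scale])
      then show ?thesis by simp
    qed
    then have "vec.dim \<Phi> \<le> vec.dim (insert p (insert q M))"
      by (intro dim_le_of_subset_span subsetI)
    then show ?thesis using vec.dim_insert[of p "insert q M"] vec.dim_insert[of q M]
      by (auto split: if_splits)
  qed
  have count: "vec.dim D + vec.dim Q \<le> mat.dim T"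
    if D: "vec.subspace D" "D \<subseteq> fac z" and Q: "Q \<subseteq> \<Phi>" "\<And>f k. f \<in> Q \<Longrightarrow> x f \<noteq> k *s z" for D Q
  proof (rule dim_add_dim_le[OF subspace_T D(1)])
    show "tens g z \<in> T" if "g \<in> D" for g using that D(2) by (auto simp: fac_def)
    show "\<exists>u L. (\<forall>c. u \<noteq> c *s z) \<and> tens f u + tens L z \<in> T" if f: "f \<in> Q" for f
    proof (intro exI conjI)
      show "\<forall>c. x f \<noteq> c *s z" using Q(2)[OF f] by blast
      have f\<Phi>: "f \<in> \<Phi>" using f Q(1) by blast
      define h where "h = f - dot f a *s q"
      have h: "h \<in> \<Phi>" "h \<in> agree 0" "f = 1 *s h + dot f a *s q"
        using f\<Phi> q by (auto simp: h_def intro!: \<Phi>_closed hyp_a)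
      \<comment> \<open>In \<open>f = h + dot f a *s q\<close>, the functional \<open>h\<close>
        agrees with \<open>0\<close> and \<open>q\<close> with \<open>z\<close>, so modulo
        \<open>T\<close> only a multiple of \<open>tens q z\<close> remains.\<close>
      have "tens f (x f) + tens ((- dot f a) *s q) z =
         (tens f (x f) - mat_scale 1 (tens h (x h)) - mat_scale (dot f a) (tens q (x q)))
        + tens h (x h - 0) + mat_scale (dot f a) (tens q (x q - z))"
        by (simp add: vec_eq_iff tens_def mat_scale_def algebra_simps)
      also have "\<dots> \<in> T"
        by (rule T_closed(1)[OF T_closed(1) T_closed(3)])
          (use lincomb[OF h(1) q(1), of 1 "dot f a"] h \<open>q \<in> agree z\<close> in
            \<open>auto simp: agree_def\<close>)
      finally show "tens f (x f) + tens ((- dot f a) *s q) z \<in> T" .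
    qed
  qed (rule z)
  have dim_Q: "vec.dim M + 1 \<le> vec.dim Q" if f: "f \<notin> M" "\<And>g. g \<in> M \<Longrightarrow> f + g \<in> Q" for f Q
  proof -
    have "f \<in> vec.span Q" using f(2)[OF vec.subspace_0[OF M_sub]] by (simp add: vec.span_base)
    moreover have "g \<in> vec.span Q" if "g \<in> M" for g
    proof -
      have "(f + g) - f \<in> vec.span Q"
        using f(2)[OF that] \<open>f \<in> vec.span Q\<close> by (intro vec.span_diff) (auto intro: vec.span_base)
      then show ?thesis by simp
    qed
    ultimately have "vec.dim (insert f M) \<le> vec.dim Q"
      by (intro dim_le_of_subset_span) auto
    then show ?thesis using f(1) vec.span_eq_iff[THEN iffD2, OF M_sub] by (simp add: vec.dim_insert del: vec.span_eq_iff)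
  qed
  show False
  proof (cases "\<exists>f\<in>\<Phi>. dot f a \<noteq> 0 \<and> dot f b \<noteq> 0 \<and> (\<exists>k. x f = k *s z)")
    case False
    \<comment> \<open>Count with \<open>D = M\<close>, where
      \<open>dim M \<ge> dim \<Phi> - 2\<close>. With two scalars, \<open>Q\<close> contains a coset
      of \<open>M\<close> and \<open>dim T \<ge> 2 dim M + 1\<close>; with more, \<open>Q\<close>
      spans \<open>\<Phi>\<close> and \<open>dim T \<ge> dim M + dim \<Phi>\<close>. Both exceed the
      bound.\<close>
    define Q where "Q = {f \<in> \<Phi>. dot f a \<noteq> 0 \<and> dot f b \<noteq> 0}"
    have cnt: "vec.dim M + vec.dim Q \<le> mat.dim T"
      using False by (intro count M_sub M_fac) (auto simp: Q_def)
    have pqM: "c *s q + p + g \<in> Q" if "g \<in> M" "c \<noteq> 0" for c g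
      using that p q by (auto simp: Q_def M_def intro!: \<Phi>_closed)
    have pqM1: "q + p + g \<in> Q" if "g \<in> M" for g
      using pqM[OF that, of 1] by simp
    have cM: "vec.dim M + 1 \<le> vec.dim Q"
      by (rule dim_Q[of "q + p"]) (use pqM1 p q in \<open>auto simp: M_def\<close>)
    show False
    proof (cases "CARD('a) = 2")
      case True
      then show False using cnt cM dim dim_\<Phi> by (simp add: d_bound_def)
    next
      case False
      then obtain k :: 'a where k: "k \<noteq> 0" "k \<noteq> 1" using exists_scalar_not_0_1 by blast
      have k1: "q + p \<in> vec.span Q" "k *s q + p \<in> vec.span Q"
        using pqM1[OF vec.subspace_0[OF M_sub]] pqM[OF vec.subspace_0[OF M_sub], of k] k
        by (auto intro: vec.span_base)
      then have "(k *s q + p) - (q + p) \<in> vec.span Q" by (rule vec.span_diff[rotated])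
      then have "(k - 1) *s q \<in> vec.span Q" by (simp add: vec.scale_left_diff_distrib)
      then have qQ: "q \<in> vec.span Q"
        by (rule scale_cancel[OF vec.subspace_span]) (use k in simp)
      then have "(q + p) - q \<in> vec.span Q" by (rule vec.span_diff[OF k1(1)])
      then have pQ: "p \<in> vec.span Q" by simp
      have "f \<in> vec.span Q" if "f \<in> \<Phi>" for f
      proof -
        define g where "g = f - dot f b *s p - dot f a *s q"
        have "g \<in> M" unfolding g_def using decomp[OF that] .
        then have "q + p + g \<in> vec.span Q" using pqM1[of g] by (auto intro: vec.span_base)
        then have "(q + p + g) - q - p + dot f b *s p + dot f a *s q \<in> vec.span Q"
          by (rule vec.span_add[OF vec.span_add[OF vec.span_diff[OF vec.span_diff[OF _ qQ] pQ]
            vec.span_scale[OF pQ]] vec.span_scale[OF qQ]])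
        then show ?thesis by (simp add: g_def)
      qed
      then have "vec.dim \<Phi> \<le> vec.dim Q" by (intro dim_le_of_subset_span subsetI)
      then show False using cnt dim dim_\<Phi> False by (simp add: d_bound_def)
    qed
  next
    case True
    then obtain f k where f: "f \<in> \<Phi>" "dot f a \<noteq> 0" "dot f b \<noteq> 0" "x f = k *s z" by blast
    define p' where "p' = f - dot f a *s q"
    have p': "p' \<in> \<Phi>" "dot p' a = 0" "dot p' b = dot f b"
      using f q by (auto simp: p'_def intro!: \<Phi>_closed)
    \<comment> \<open>Here \<open>f\<close>, \<open>p'\<close> and \<open>q\<close> agree with
      \<open>k *s z\<close>, \<open>0\<close> and \<open>z\<close>, and \<open>fac_lincomb\<close>
      yields this element of \<open>fac z\<close>. It is nonzero at \<open>a\<close> and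
      \<open>b\<close> once \<open>k\<close> is neither 0 nor 1.\<close>
    define \<zeta> where "\<zeta> = (1 * (0 - k)) *s p' + (dot f a * (1 - k)) *s q"
    have \<zeta>_fac: "\<zeta> \<in> fac z"
      unfolding \<zeta>_def
    proof (rule fac_lincomb)
      show "p' \<in> agree (0 *s z)" "q \<in> agree (1 *s z)"
        using hyp_a p' \<open>q \<in> agree z\<close> by auto
      show "1 *s p' + dot f a *s q \<in> agree (k *s z)"
        using agree_self[OF f(1)] f(4) by (simp add: p'_def)
    qed
    have "k \<noteq> 0"
    proof
      assume "k = 0"
      then have "dot f a *s q \<in> fac z" using \<zeta>_fac by (simp add: \<zeta>_def)
      then have "q \<in> fac z" by (rule scale_cancel[OF subspace_fac]) (rule f(2))
      then show False
        using agree_shift_line[of q 1 z 0] \<open>q \<in> agree z\<close> q0 by simp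
    qed
    have "k \<noteq> 1"
    proof
      assume "k = 1"
      then have "(-1) *s p' \<in> fac z" using \<zeta>_fac by (simp add: \<zeta>_def)
      then have "p' \<in> fac z" by (rule scale_cancel[OF subspace_fac]) simp
      then have "p' \<in> agree z"
        using agree_shift_line[of p' 0 z 1] hyp_a p' by simp
      moreover have "p' - dot f b *s p \<in> agree z"
        using p p' by (intro hyp_b) (auto intro!: \<Phi>_closed)
      ultimately have "p' - (p' - dot f b *s p) \<in> agree z" by (rule agree_closed)
      then have "dot f b *s p \<in> agree z" by simp
      then have "p \<in> agree z" by (rule scale_cancel[OF subspace_agree]) (rule f(3))
      then show False using pz by simp
    qed
    have \<zeta>_ab: "dot \<zeta> a \<noteq> 0" "dot \<zeta> b \<noteq> 0"
      using \<open>k \<noteq> 0\<close> \<open>k \<noteq> 1\<close> p' q f by (auto simp: \<zeta>_def)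
    \<comment> \<open>Count with \<open>D = fac z\<close>: both \<open>fac z\<close> and
      \<open>Q\<close> contain the coset \<open>\<zeta> + M\<close>, which gives
      \<open>dim T \<ge> 2 dim M + 2\<close>.\<close>
    define Q where "Q = {h \<in> fac z. dot h a \<noteq> 0 \<and> dot h b \<noteq> 0}"
    have \<zeta>Q: "\<zeta> + g \<in> Q" if "g \<in> M" for g
      using that M_fac \<zeta>_fac \<zeta>_ab by (auto simp: Q_def M_def intro!: fac_closed)
    have "vec.dim M + 1 \<le> vec.dim Q"
      by (rule dim_Q[of \<zeta>]) (use \<zeta>Q \<zeta>_ab in \<open>auto simp: M_def\<close>)
    moreover have "vec.dim M + 1 \<le> vec.dim (fac z)"
      by (rule dim_Q[of \<zeta>]) (use \<zeta>Q \<zeta>_ab in \<open>auto simp: M_def Q_def\<close>)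
    moreover have "vec.dim (fac z) + vec.dim Q \<le> mat.dim T"
    proof (rule count[OF subspace_fac])
      show "Q \<subseteq> \<Phi>" by (auto simp: Q_def fac_def)
      show "x h \<noteq> l *s z" if "h \<in> Q" for h l
      proof
        assume eq: "x h = l *s z"
        have h: "h \<in> \<Phi>" "h \<in> fac z" "dot h a \<noteq> 0" using that by (auto simp: Q_def fac_def)
        have "h \<in> agree 0"
          using agree_shift_line[of h l z 0] agree_self[OF h(1)] eq h by simp
        moreover have "h - dot h a *s q \<in> agree 0"
          using h q by (intro hyp_a) (auto intro!: \<Phi>_closed)
        ultimately have "h - (h - dot h a *s q) \<in> agree 0" by (rule agree_closed)
        then have "dot h a *s q \<in> agree 0" by simp
        then have "q \<in> agree 0" by (rule scale_cancel[OF subspace_agree]) (rule h(3))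
        then show False using q0 by simp
      qed
    qed simp
    ultimately show False using dim dim_\<Phi> by (simp add: d_bound_def split: if_splits)
  qed
qed

section \<open>Shifting by a constant and restricting to a hyperplane\<close>

lemma rc_family_shift: "rc_family \<Phi> T (\<lambda>f. x f - w)"
proof
  show "tens (f + g) (x (f + g) - w) - tens f (x f - w) - tens g (x g - w) \<in> T"
    if "f \<in> \<Phi>" "g \<in> \<Phi>" for f g
    using add[OF that] by (simp add: tens_simps algebra_simps)
  show "tens (c *s f) (x (c *s f) - w) - mat_scale c (tens f (x f - w)) \<in> T"
    if "f \<in> \<Phi>" for c f
    using scale[OF that, of c] by (simp add: tens_simps mat.scale_right_diff_distrib)
qed (use subspace_\<Phi> subspace_T supp in auto)

lemma agree_shifted: "rc_family.agree \<Phi> T (\<lambda>f. x f - w) v = agree (v + w)"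
  by (simp add: rc_family.agree_def[OF rc_family_shift] agree_def algebra_simps)

text \<open>The quotient by \<open>a\<close> seen on the dual side. Tensors built from functionals
  vanishing at \<open>a\<close> are killed by \<open>a\<close>, so the linearity defects stay in the
  smaller space.\<close>

lemma rc_family_hyperplane:
  assumes p: "p \<in> \<Phi>" "dot p a \<noteq> 0"
  shows "rc_family {f \<in> \<Phi>. dot f a = 0} {t \<in> T. act t a = 0} x"
proof
  show "vec.subspace {f \<in> \<Phi>. dot f a = 0}"
    by (auto simp: vec.subspace_def intro!: \<Phi>_closed)
  show "mat.subspace {t \<in> T. act t a = 0}"
    by (auto simp: mat.subspace_def intro!: T_closed)
  show "act t b = 0" if t: "t \<in> {t \<in> T. act t a = 0}"
    and b: "\<And>f. f \<in> {f \<in> \<Phi>. dot f a = 0} \<Longrightarrow> dot f b = 0" for t b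
  proof -
    have "dot f (b - (dot p b / dot p a) *s a) = 0" if "f \<in> \<Phi>" for f
    proof -
      have "dot (f - (dot f a / dot p a) *s p) b = 0"
        using p that by (intro b) (auto intro!: \<Phi>_closed)
      then show ?thesis by (simp add: algebra_simps)
    qed
    then have "act t (b - (dot p b / dot p a) *s a) = 0" using supp t by blast
    then show ?thesis using t by simp
  qed
qed (use add scale in auto)

lemma agree_hyperplane:
  assumes "p \<in> \<Phi>" "dot p a \<noteq> 0"
  shows "rc_family.agree {f \<in> \<Phi>. dot f a = 0} {t \<in> T. act t a = 0} x w \<subseteq> agree w"
  by (auto simp: rc_family.agree_def[OF rc_family_hyperplane[OF assms]] agree_def)

lemma dim_hyperplane:
  assumes p: "p \<in> \<Phi>" "dot p a \<noteq> 0"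
  shows "vec.dim \<Phi> = vec.dim {f \<in> \<Phi>. dot f a = 0} + 1"
proof -
  let ?H = "{f \<in> \<Phi>. dot f a = 0}"
  have sub: "vec.subspace ?H" by (auto simp: vec.subspace_def intro!: \<Phi>_closed)
  have "f \<in> vec.span (insert p ?H)" if "f \<in> \<Phi>" for f
  proof -
    have "(f - (dot f a / dot p a) *s p) + (dot f a / dot p a) *s p \<in> vec.span (insert p ?H)"
      by (rule vec.span_add[OF vec.span_base vec.span_scale[OF vec.span_base]])
        (use that p in \<open>auto intro!: \<Phi>_closed\<close>)
    then show ?thesis by simp
  qed
  moreover have "insert p ?H \<subseteq> \<Phi>" using p by auto
  ultimately have "vec.dim \<Phi> = vec.dim (insert p ?H)"
    by (intro antisym dim_le_of_subset_span vec.dim_subset) (auto intro: vec.span_base)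
  then show ?thesis using p vec.span_eq_iff[THEN iffD2, OF sub] by (simp add: vec.dim_insert del: vec.span_eq_iff)
qed

text \<open>Contract the additivity defect of \<open>f0\<close> and \<open>f\<close> with vectors
  dual to them: \<open>x (f0 + f)\<close> differs from both \<open>x f0\<close> and
  \<open>x f\<close> by multiples of \<open>u\<close>. After a shift by \<open>x f0\<close>, the
  covering lemma applies.\<close>

lemma local_of_common_line:
  assumes line: "\<And>t b. t \<in> T \<Longrightarrow> \<exists>c. act t b = c *s u"
  shows "\<exists>w. \<Phi> \<subseteq> agree w"
proof (cases "\<exists>f0\<in>\<Phi>. f0 \<noteq> 0")
  case False
  then have "\<Phi> \<subseteq> agree 0" using agree_closed(4) by auto
  then show ?thesis by blast
next
  case True
  then obtain f0 where f0: "f0 \<in> \<Phi>" "f0 \<noteq> 0" by blast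
  interpret s: rc_family \<Phi> T "\<lambda>f. x f - x f0" by (rule rc_family_shift)
  have "\<exists>l. f \<in> s.agree (l *s u)" if f: "f \<in> \<Phi>" for f
  proof (cases "f \<in> vec.span {f0}")
    case True
    then obtain c where "f = c *s f0" by (auto simp: vec.span_singleton)
    then have "f \<in> agree (x f0)" using agree_closed(3) agree_self[OF f0(1)] by blast
    then have "f \<in> s.agree (0 *s u)" by (simp add: agree_shifted)
    then show ?thesis by blast
  next
    case False
    have "f0 \<notin> vec.span {f}"
    proof
      assume "f0 \<in> vec.span {f}"
      then obtain c where "f0 = c *s f" by (auto simp: vec.span_singleton)
      with f0(2) have "f = inverse c *s f0" by (cases "c = 0") auto
      then show False using False by (simp add: vec.span_base vec.span_scale)
    qed
    then obtain c where "\<And>h. h \<in> vec.span {f} \<Longrightarrow> dot h c = 0" and c1: "dot f0 c = 1"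
      using dot_separation by metis
    then have c0: "dot f c = 0" by (simp add: vec.span_base)
    obtain d where "\<And>h. h \<in> vec.span {f0} \<Longrightarrow> dot h d = 0" and d1: "dot f d = 1"
      using dot_separation[OF False] by metis
    then have d0: "dot f0 d = 0" by (simp add: vec.span_base)
    obtain k l where "x (f0 + f) - x f0 = k *s u" "x (f0 + f) - x f = l *s u"
      using line[OF add[OF f0(1) f], of c] line[OF add[OF f0(1) f], of d] c0 c1 d0 d1 by auto
    then have "x f - x f0 = (k - l) *s u"
      by (simp add: vec.scale_left_diff_distrib algebra_simps)
    then show ?thesis using s.agree_self[OF f] by metis
  qed
  then obtain v where "\<Phi> \<subseteq> s.agree v" using s.local_of_covering by blast
  then show ?thesis by (auto simp: agree_shifted)
qed

end

subsection \<open>Induction on the dimension\<close>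

text \<open>Linear independence of an ordered pair; the set \<open>{u, v}\<close> would be a
  singleton for \<open>u = v\<close>.\<close>

definition indep2 :: "'a::field^'p \<Rightarrow> 'a^'p \<Rightarrow> bool" where
  "indep2 u v \<longleftrightarrow> u \<noteq> 0 \<and> (\<forall>c. v \<noteq> c *s u)"

lemma indep2D:
  assumes "indep2 u v" "a *s u + b *s v = 0"
  shows "a = 0" "b = 0"
proof -
  show b: "b = 0"
  proof (rule ccontr)
    assume "b \<noteq> 0"
    have "v = inverse b *s (b *s v)" using \<open>b \<noteq> 0\<close> by simp
    also have "b *s v = - (a *s u)" using assms(2) by (metis add.commute eq_neg_iff_add_eq_0)
    finally have "v = (- (inverse b * a)) *s u" by (simp add: vec.scale_minus_left)
    then show False using assms(1) unfolding indep2_def by blast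
  qed
  show "a = 0" using assms b by (auto simp: indep2_def)
qed

lemma line_of_not_indep2:
  assumes "\<And>s t. s \<in> T \<Longrightarrow> t \<in> T \<Longrightarrow> \<not> indep2 (act s b) (act t b)"
  shows "\<exists>u. \<forall>t\<in>T. \<exists>c. act t b = c *s u"
proof (cases "\<exists>s\<in>T. act s b \<noteq> 0")
  case True
  then show ?thesis using assms by (auto simp: indep2_def)
next
  case False
  then have "\<forall>t\<in>T. \<exists>c. act t b = c *s 0" by auto
  then show ?thesis by blast
qed

text \<open>As each \<open>T b\<close> lies in a line, \<open>act t b\<close> is a multiple of
  \<open>act t0 b\<close> wherever the latter is nonzero. Comparing the multiples at
  \<open>b1\<close>, at \<open>b2\<close> and at sums forces them to vanish.\<close>

lemma (in rc_family) kernel_trivial: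
  assumes lines: "\<And>b. \<exists>u. \<forall>t\<in>T. \<exists>c. act t b = c *s u"
    and t0: "t0 \<in> T" "indep2 (act t0 b1) (act t0 b2)"
    and t: "t \<in> T" "act t b1 = 0"
  shows "t = 0"
proof (rule act_eq_0D)
  let ?u1 = "act t0 b1" and ?u2 = "act t0 b2"
  have u: "?u1 \<noteq> 0" "?u2 \<noteq> 0" using indep2D[OF t0(2), of 0 1] t0(2) by (auto simp: indep2_def)
  have par: "\<exists>c. act t b = c *s act t0 b" if "act t0 b \<noteq> 0" for b
  proof -
    obtain w where w: "\<And>t. t \<in> T \<Longrightarrow> \<exists>c. act t b = c *s w" using lines by blast
    obtain c d where cd: "act t0 b = c *s w" "act t b = d *s w" using w t t0 by metis
    then have "act t b = (d / c) *s act t0 b" using that by auto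
    then show ?thesis by blast
  qed
  have sum: "?u1 + ?u2 \<noteq> 0" using indep2D[OF t0(2), of 1 1] by auto
  have tb2: "act t b2 = 0"
  proof -
    obtain c where c: "act t b2 = c *s ?u2" using par u by blast
    obtain d where d: "act t (b1 + b2) = d *s act t0 (b1 + b2)" using par[of "b1 + b2"] sum by auto
    have "d *s ?u1 + (d - c) *s ?u2 = 0"
      using c d t(2) by (simp add: vec.scale_left_diff_distrib vec.scale_right_distrib)
    then have "d = 0" by (rule indep2D[OF t0(2)])
    then show ?thesis using d t(2) by simp
  qed
  show "act t b = 0" for b
  proof (cases "\<exists>d. act t0 b = d *s ?u1")
    case True
    then obtain d where d: "act t0 b = d *s ?u1" by blast
    \<comment> \<open>Since \<open>act t b2 = 0\<close>, moving from \<open>b\<close> to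
      \<open>b + b2\<close> keeps the value of \<open>t\<close> but changes the line containing it;
      the two lines meet only in 0.\<close>
    have "act t0 (b + b2) \<noteq> 0" using indep2D(2)[OF t0(2), of d 1] d by auto
    then obtain c where c: "act t b = c *s (d *s ?u1 + ?u2)"
      using par[of "b + b2"] d tb2 by auto
    have "\<exists>c'. act t b = c' *s ?u1"
    proof (cases "d = 0")
      case True
      then show ?thesis using par[of "b + b1"] u d t(2) by simp
    next
      case False
      then show ?thesis using par[of b] u d by auto
    qed
    then obtain c' where c': "act t b = c' *s ?u1" by blast
    have "(c * d - c') *s ?u1 + c *s ?u2 = 0"
      using c c' by (simp add: vec.scale_left_diff_distrib vec.scale_right_distrib)
    then have "c = 0" by (rule indep2D[OF t0(2)])
    then show ?thesis using c by simp
  next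
    case False
    have nz: "act t0 b \<noteq> 0" using False by (metis vec.scale_zero_left)
    have ind: "indep2 ?u1 (act t0 b)" using u False by (auto simp: indep2_def)
    obtain c where c: "act t b = c *s act t0 b" using par nz by blast
    have "act t0 (b + b1) \<noteq> 0" using indep2D[OF ind, of 1 1] by (auto simp: add.commute)
    then obtain d where d: "act t b = d *s (act t0 b + ?u1)"
      using par[of "b + b1"] t(2) by auto
    have "d *s ?u1 + (d - c) *s act t0 b = 0"
      using c d by (simp add: vec.scale_left_diff_distrib vec.scale_right_distrib algebra_simps)
    then have "d = 0" by (rule indep2D[OF ind])
    then show ?thesis using d by simp
  qed
qed

text \<open>Either \<open>T\<close> has dimension one, or all its elements have their range in a common line.\<close>

lemma (in rc_family) local_of_all_lines:
  assumes lines: "\<And>b. \<exists>u. \<forall>t\<in>T. \<exists>c. act t b = c *s u"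
    and dim: "int (mat.dim T) \<le> d_bound (vec.dim \<Phi>) TYPE('a)"
  shows "\<exists>w. \<Phi> \<subseteq> agree w"
proof (cases "\<exists>t0\<in>T. \<exists>b1 b2. indep2 (act t0 b1) (act t0 b2)")
  case True
  then obtain t0 b1 b2 where t0: "t0 \<in> T" "indep2 (act t0 b1) (act t0 b2)" by blast
  have ker: "{t \<in> T. act t b1 = 0} \<subseteq> {0}"
    using kernel_trivial[OF lines t0] by blast
  obtain p where p: "p \<in> \<Phi>" "dot p b1 \<noteq> 0"
    using supp[OF t0(1), of b1] t0(2) by (auto simp: indep2_def)
  interpret r: rc_family "{f \<in> \<Phi>. dot f b1 = 0}" "{t \<in> T. act t b1 = 0}" x
    by (rule rc_family_hyperplane[OF p])
  have "\<exists>w. {f \<in> \<Phi>. dot f b1 = 0} \<subseteq> r.agree w"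
    by (rule r.local_of_common_line[of 0]) (use ker in auto)
  then obtain w where w: "{f \<in> \<Phi>. dot f b1 = 0} \<subseteq> agree w"
    using agree_hyperplane[OF p] by blast
  interpret s: rc_family \<Phi> T "\<lambda>f. x f - w" by (rule rc_family_shift)
  have "t0 \<noteq> 0" using t0(2) by (auto simp: indep2_def)
  then have "mat.dim {t0} = 1" by (simp add: mat.dim_eq_card_independent)
  then have "mat.dim T \<ge> 1" using mat.dim_subset[of "{t0}" T] t0(1) by simp
  \<comment> \<open>With \<open>dim T \<ge> 1\<close>, the bound gives
    \<open>dim \<Phi> \<ge> 3\<close> over two elements and \<open>dim \<Phi> \<ge> 2\<close>
    otherwise.\<close>
  then have dims: "vec.dim \<Phi> \<ge> 3 \<or> vec.dim \<Phi> \<ge> 2 \<and> (\<exists>k::'a. k \<noteq> 0 \<and> k \<noteq> 1)"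
    using dim exists_scalar_not_0_1[where 'a = 'a] by (auto simp: d_bound_def split: if_splits)
  have "\<exists>v. \<Phi> \<subseteq> s.agree v"
    by (rule s.local_of_lines[of b1]) (use w lines dims in \<open>auto simp: agree_shifted\<close>)
  then show ?thesis by (auto simp: agree_shifted)
next
  case False
  have "\<exists>u. \<forall>t\<in>T. \<forall>b. \<exists>c. act t b = c *s u"
  proof (cases "\<exists>t1\<in>T. \<exists>b1. act t1 b1 \<noteq> 0")
    case no: False
    then have "\<forall>t\<in>T. \<forall>b. \<exists>c. act t b = c *s 0" by auto
    then show ?thesis by blast
  next
    case True
    then obtain t1 b1 where t1: "t1 \<in> T" "act t1 b1 \<noteq> 0" by blast
    let ?u = "act t1 b1"
    have rank1: "\<exists>c. act t b' = c *s act t b" if "t \<in> T" "act t b \<noteq> 0" for t b b'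
      using False that unfolding indep2_def by blast
    have "\<exists>c. act t b = c *s ?u" if t: "t \<in> T" for t b
    proof (rule ccontr)
      assume n: "\<not> ?thesis"
      have nz: "act t b \<noteq> 0" using n by (metis vec.scale_zero_left)
      have ind: "indep2 ?u (act t b)" using n t1 by (auto simp: indep2_def)
      have "act t b1 = 0"
      proof -
        obtain c where c: "act t b1 = c *s act t b" using rank1 t nz by blast
        obtain w where "\<And>t. t \<in> T \<Longrightarrow> \<exists>c. act t b1 = c *s w" using lines by blast
        then obtain k l where kl: "?u = k *s w" "act t b1 = l *s w" using t t1 by metis
        have "l *s ?u + (- (k * c)) *s act t b = 0"
          using c kl by (metis add.right_inverse mult.commute vec.scale_minus_left vec.scale_scale)
        then have "l = 0" by (rule indep2D[OF ind])
        then show ?thesis using kl by simp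
      qed
      moreover have "act t1 b = 0"
      proof -
        obtain c where c: "act t1 b = c *s ?u" using rank1 t1 by blast
        obtain w where "\<And>t. t \<in> T \<Longrightarrow> \<exists>c. act t b = c *s w" using lines by blast
        then obtain k l where kl: "act t b = k *s w" "act t1 b = l *s w" using t t1 by metis
        have "(- (k * c)) *s ?u + l *s act t b = 0"
          using c kl by (metis add.left_inverse mult.commute vec.scale_minus_left vec.scale_scale)
        then have "l = 0" by (rule indep2D[OF ind])
        then show ?thesis using kl by simp
      qed
      \<comment> \<open>In this case all elements of \<open>T\<close> have rank at most one, but
        \<open>t1 + t\<close> would take two independent values.\<close>
      ultimately have "act (t1 + t) b1 = ?u" "act (t1 + t) b = act t b" by simp_all
      then show False using rank1[of "t1 + t" b1 b] T_closed(1)[OF t1(1) t] t1(2) n by simp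
    qed
    then show ?thesis by blast
  qed
  then show ?thesis using local_of_common_line by blast
qed

lemma (in rc_family) dim_kernel:
  assumes s: "s \<in> T" and t: "t \<in> T" and ind: "indep2 (act s a) (act t a)"
  shows "mat.dim {t \<in> T. act t a = 0} + 2 \<le> mat.dim T"
proof -
  let ?K = "{t \<in> T. act t a = 0}"
  have sub: "mat.subspace ?K" by (auto simp: mat.subspace_def intro!: T_closed)
  have K: "mat.span ?K = ?K" using sub by (simp add: mat.span_eq_iff)
  have "s \<notin> mat.span ?K" using ind unfolding K by (auto simp: indep2_def)
  moreover have "t \<notin> mat.span (insert s ?K)"
  proof
    assume "t \<in> mat.span (insert s ?K)"
    then obtain c where "t - mat_scale c s \<in> ?K"
      using mat.span_breakdown_eq[of t s ?K] unfolding K by blast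
    then have "act t a = c *s act s a" by simp
    then show False using ind unfolding indep2_def by blast
  qed
  ultimately have "mat.dim (insert t (insert s ?K)) = mat.dim ?K + 2"
    by (simp add: mat.dim_insert del: mat.span_eq_iff)
  moreover have "mat.dim (insert t (insert s ?K)) \<le> mat.dim T"
    by (rule mat.dim_subset) (use s t in auto)
  ultimately show ?thesis by simp
qed

text \<open>The theorem in dual form, with \<open>\<Phi>\<close> and \<open>T\<close> arbitrary so
  that the induction can pass to hyperplanes.\<close>

theorem rc_family_local:
  fixes \<Phi> :: "('a::field^'n) set" and T :: "('a^'p^'n) set"
  assumes "rc_family \<Phi> T x" "int (mat.dim T) \<le> d_bound (vec.dim \<Phi>) TYPE('a)"
  shows "\<exists>w. \<Phi> \<subseteq> rc_family.agree \<Phi> T x w"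
  using assms
proof (induction "vec.dim \<Phi>" arbitrary: \<Phi> T x rule: less_induct)
  case less
  interpret rc_family \<Phi> T x by (rule less.prems(1))
  \<comment> \<open>Passing from \<open>\<Phi>\<close> to \<open>\<Phi> \<inter> a\<^sup>\<bottom>\<close> lowers the bound by 2; \<open>a\<close> is good if \<open>dim T\<close> drops by as much.\<close>
  define good where "good a \<longleftrightarrow> (\<exists>s\<in>T. \<exists>t\<in>T. indep2 (act s a) (act t a))" for a
  have quotient: "\<exists>w. {f \<in> \<Phi>. dot f a = 0} \<subseteq> agree w" "\<exists>p\<in>\<Phi>. dot p a \<noteq> 0" "mat.dim T \<ge> 2"
    if a: "good a" for a
  proof -
    obtain s t where st: "s \<in> T" "t \<in> T" "indep2 (act s a) (act t a)"
      using a by (auto simp: good_def)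
    obtain p where p: "p \<in> \<Phi>" "dot p a \<noteq> 0"
      using supp[OF st(1), of a] st(3) by (auto simp: indep2_def)
    then show "\<exists>p\<in>\<Phi>. dot p a \<noteq> 0" by blast
    show "mat.dim T \<ge> 2" using dim_kernel[OF st] by simp
    have "\<exists>w. {f \<in> \<Phi>. dot f a = 0} \<subseteq> rc_family.agree {f \<in> \<Phi>. dot f a = 0} {t \<in> T. act t a = 0} x w"
    proof (rule less.hyps[OF _ rc_family_hyperplane[OF p]])
      show "vec.dim {f \<in> \<Phi>. dot f a = 0} < vec.dim \<Phi>" using dim_hyperplane[OF p] by simp
      show "int (mat.dim {t \<in> T. act t a = 0}) \<le> d_bound (vec.dim {f \<in> \<Phi>. dot f a = 0}) TYPE('a)"
        using dim_hyperplane[OF p] dim_kernel[OF st] less.prems(2)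
        by (simp add: d_bound_def split: if_splits)
    qed
    then show "\<exists>w. {f \<in> \<Phi>. dot f a = 0} \<subseteq> agree w" using agree_hyperplane[OF p] by blast
  qed
  show ?case
  proof (cases "\<exists>a. good a")
    case False
    have "\<exists>u. \<forall>t\<in>T. \<exists>c. act t b = c *s u" for b
      by (rule line_of_not_indep2) (use False in \<open>auto simp: good_def\<close>)
    then show ?thesis using local_of_all_lines less.prems(2) by blast
  next
    case True
    then obtain a where a: "good a" by blast
    obtain w where w: "{f \<in> \<Phi>. dot f a = 0} \<subseteq> agree w" using quotient(1)[OF a] by blast
    interpret s: rc_family \<Phi> T "\<lambda>f. x f - w" by (rule rc_family_shift)
    have hyp_a: "f \<in> s.agree 0" if "f \<in> \<Phi>" "dot f a = 0" for f
      using w that by (auto simp: agree_shifted)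
    have "\<exists>v. \<Phi> \<subseteq> s.agree v"
    proof (cases "\<exists>b. good b \<and> (\<forall>k. \<exists>f\<in>\<Phi>. dot f b \<noteq> k * dot f a)")
      case True
      then obtain b where b: "good b" "\<And>k. \<exists>f\<in>\<Phi>. dot f b \<noteq> k * dot f a" by blast
      obtain w' where w': "{f \<in> \<Phi>. dot f b = 0} \<subseteq> agree w'" using quotient(1)[OF b(1)] by blast
      obtain h where h: "h \<in> \<Phi>" "dot h a \<noteq> 0" using quotient(2)[OF a] by blast
      obtain f where f: "f \<in> \<Phi>" "dot f b \<noteq> dot h b / dot h a * dot f a" using b(2) by blast
      \<comment> \<open>From \<open>f\<close> and \<open>h\<close> a pair \<open>p\<close>,
        \<open>q\<close> dual to \<open>b\<close>, \<open>a\<close> is built; this is possible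
        because \<open>b\<close> is not proportional to \<open>a\<close> on
        \<open>\<Phi>\<close>.\<close>
      define p0 where "p0 = f - (dot f a / dot h a) *s h"
      have p0: "p0 \<in> \<Phi>" "dot p0 a = 0" "dot p0 b \<noteq> 0"
        using f h by (auto simp: p0_def mult.commute intro!: \<Phi>_closed)
      define p where "p = inverse (dot p0 b) *s p0"
      have p: "p \<in> \<Phi>" "dot p a = 0" "dot p b = 1"
        using p0 by (auto simp: p_def intro!: \<Phi>_closed)
      define q where "q = inverse (dot h a) *s (h - dot h b *s p)"
      have q: "q \<in> \<Phi>" "dot q a = 1" "dot q b = 0"
        using p h by (auto simp: q_def intro!: \<Phi>_closed)
      show ?thesis
      proof (rule s.local_of_two_hyperplanes[OF hyp_a _ p q less.prems(2)])
        show "f \<in> s.agree (w' - w)" if "f \<in> \<Phi>" "dot f b = 0" for f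
          using w' that by (auto simp: agree_shifted)
      qed
    next
      case False
      show ?thesis
      proof (rule s.local_of_lines[OF hyp_a])
        show "\<exists>u. \<forall>t\<in>T. \<exists>c. act t b = c *s u" if "\<And>k. \<exists>f\<in>\<Phi>. dot f b \<noteq> k * dot f a" for b
        proof (rule line_of_not_indep2)
          have "\<not> good b" using False that by blast
          then show "\<not> indep2 (act s b) (act t b)" if "s \<in> T" "t \<in> T" for s t
            using that by (auto simp: good_def)
        qed
        \<comment> \<open>Here \<open>dim T \<ge> 2\<close>, so both forms of the bound give
          \<open>dim \<Phi> \<ge> 3\<close>.\<close>
        show "vec.dim \<Phi> \<ge> 3 \<or> vec.dim \<Phi> \<ge> 2 \<and> (\<exists>k::'a. k \<noteq> 0 \<and> k \<noteq> 1)"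
          using quotient(3)[OF a] less.prems(2) by (auto simp: d_bound_def split: if_splits)
      qed
    qed
    then show ?thesis by (auto simp: agree_shifted)
  qed
qed

subsection \<open>From range-compatible maps to families\<close>

definition pairing :: "'a::field^'p^'n \<Rightarrow> 'a^'p^'n \<Rightarrow> 'a" where
  "pairing t s = (\<Sum>i\<in>UNIV. \<Sum>j\<in>UNIV. t $ i $ j * s $ i $ j)"

lemma pairing_simps:
  "pairing (t + t') s = pairing t s + pairing t' s"
  "pairing (t - t') s = pairing t s - pairing t' s"
  "pairing (mat_scale c t) s = c * pairing t s"
  "pairing t (s + s') = pairing t s + pairing t s'"
  "pairing t (mat_scale c s) = c * pairing t s"
  "pairing 0 s = 0" "pairing t 0 = 0"
  unfolding pairing_def mat_scale_def
  by (simp_all add: algebra_simps sum.distrib sum_distrib_left sum_subtractf)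

lemma pairing_tens: "pairing (tens f u) s = dot f (s *v u)"
  unfolding pairing_def tens_def dot_def matrix_vector_mult_def
  by (simp add: sum_distrib_left algebra_simps)

lemma pairing_mat_unit: "pairing t (mat_unit (i, j)) = t $ i $ j"
  unfolding pairing_def mat_unit_def tens_def axis_def
  by (simp add: if_distrib[where f="\<lambda>x. _ * x"] if_distrib[where f="\<lambda>x. x * _"] cong: if_cong)

text \<open>Complete a basis of \<open>S\<close> to one of the whole space. A functional vanishing
  on \<open>S\<close> is determined by its values on the added vectors, which \<open>h\<close>
  records as coefficients.\<close>

lemma dim_annihilator:
  fixes S :: "('a::field^'p^'n) set"
  assumes "mat.subspace S"
  shows "int (mat.dim {t. \<forall>s\<in>S. pairing t s = 0}) \<le> mat_codim S"
proof -
  let ?A = "{t. \<forall>s\<in>S. pairing t s = 0}"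
  obtain B where B: "B \<subseteq> S" "mat.independent B" "S \<subseteq> mat.span B" "card B = mat.dim S"
    using mat.basis_exists by metis
  define C where "C = mat.extend_basis B"
  have C: "B \<subseteq> C" "mat.independent C" "mat.span C = UNIV"
    using mat.extend_basis_superset[OF B(2)] mat.independent_extend_basis[OF B(2)]
      mat.span_extend_basis[OF B(2)] by (simp_all add: C_def)
  have fin: "finite C" using C(2) by (rule mat.finiteI_independent)
  have cardC: "card C = mat.dim (UNIV :: ('a^'p^'n) set)"
    using C by (metis mat.dim_span mat.dim_eq_card_independent)
  define h where "h t = (\<Sum>c\<in>C - B. mat_scale (pairing t c) c)" for t
  have lin: "Vector_Spaces.linear mat_scale mat_scale h"
    by unfold_locales
      (simp_all add: h_def pairing_simps mat.scale_left_distrib sum.distrib mat.scale_sum_right)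
  have sub: "mat.subspace ?A"
    by (auto simp: mat.subspace_def pairing_simps)
  have A: "mat.span ?A = ?A" using sub by (simp add: mat.span_eq_iff)
  interpret h: Vector_Spaces.linear mat_scale mat_scale h by (rule lin)
  have "t = 0" if t: "t \<in> ?A" "h t = 0" for t
  proof -
    have pc: "pairing t c = 0" if "c \<in> C" for c
    proof (cases "c \<in> B")
      case True then show ?thesis using t B(1) by blast
    next
      case False
      have "mat.independent (C - B)" using C(2) by (rule mat.independent_mono) auto
      then show ?thesis
        using t(2) False that fin unfolding h_def
        by (intro mat.independentD[of "C - B" "C - B" "pairing t" c]) auto
    qed
    have "pairing t s = 0" if "s \<in> mat.span C" for s
      using that by (induction rule: mat.span_induct_alt) (auto simp: pairing_simps pc)
    then show "t = 0"
      using C(3) by (metis UNIV_I pairing_mat_unit vec_eq_iff zero_index)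
  qed
  then have inj: "inj_on h (mat.span ?A)"
    unfolding A by (subst h.inj_on_iff_eq_0[OF sub]) auto
  interpret mat_mat: finite_dimensional_vector_space_pair
    "mat_scale :: 'a \<Rightarrow> 'a^'p^'n \<Rightarrow> 'a^'p^'n" mat_basis
    "mat_scale :: 'a \<Rightarrow> 'a^'p^'n \<Rightarrow> 'a^'p^'n" mat_basis
    by unfold_locales
  have "mat.dim ?A = mat.dim (h ` ?A)"
    by (rule mat_mat.dim_image_eq[OF lin inj, symmetric])
  also have "\<dots> \<le> card (C - B)"
  proof (rule mat.dim_le_card)
    show "h ` ?A \<subseteq> mat.span (C - B)"
      unfolding h_def by (intro image_subsetI mat.span_sum mat.span_scale mat.span_base) auto
  qed (use fin in simp)
  finally show ?thesis
    using B(4) C(1) cardC fin card_mono[OF fin C(1)] card_Diff_subset[OF finite_subset[OF C(1) fin] C(1)]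
    by (simp add: mat_codim_def)
qed

text \<open>The functional \<open>f s \<mapsto> f (F s)\<close> on the row space \<open>{f s. s \<in> S}\<close> is well defined by range
  compatibility. It is represented by a vector \<open>u\<close> found by separating the new unit vector
  from its graph in \<open>K\<^sup>p\<^sup>+\<^sup>1\<close>, which is modelled by the index type \<open>'p option\<close>.\<close>

lemma range_functional:
  fixes S :: "('a::field^'p^'n) set"
  assumes S: "mat.subspace S" and F: "linear_on_mat S F" "range_compatible S F"
  shows "\<exists>u. \<forall>s\<in>S. dot f (F s) = dot f (s *v u)"
proof -
  define r :: "'a^'p^'n \<Rightarrow> 'a^('p option)" where
    "r s = (\<chi> k. case k of None \<Rightarrow> dot f (F s) | Some j \<Rightarrow> act s f $ j)" for s
  have eq_dot: "dot f (s *v u) = dot (act s f) u" for s :: "'a^'p^'n" and u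
    unfolding dot_def act_def matrix_vector_mult_def
    by (simp add: sum_distrib_left sum_distrib_right mult_ac sum.swap[of _ "UNIV::'p set"])
  have sub: "vec.subspace (r ` S)"
  proof (unfold vec.subspace_def, intro conjI ballI allI)
    have "F 0 = 0"
      using F(1) mat.subspace_0[OF S] unfolding linear_on_mat_def
      by (metis mat.scale_zero_left vec.scale_zero_left)
    then have "r 0 = 0" by (intro vec_eq_iff[THEN iffD2] allI) (simp add: r_def split: option.splits)
    then show "0 \<in> r ` S" using mat.subspace_0[OF S] by (metis imageI)
    fix v w assume "v \<in> r ` S" "w \<in> r ` S"
    then obtain s t where st: "s \<in> S" "t \<in> S" "v = r s" "w = r t" by blast
    have "r (s + t) = v + w"
      unfolding st(3,4) using F(1) st(1,2)
      by (intro vec_eq_iff[THEN iffD2] allI) (simp add: r_def linear_on_mat_def split: option.splits)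
    then show "v + w \<in> r ` S" using mat.subspace_add[OF S] st by (metis imageI)
  next
    fix c v assume "v \<in> r ` S"
    then obtain s where s: "s \<in> S" "v = r s" by blast
    have "r (mat_scale c s) = c *s v"
      unfolding s(2) using F(1) s(1)
      by (intro vec_eq_iff[THEN iffD2] allI) (simp add: r_def linear_on_mat_def split: option.splits)
    then show "c *s v \<in> r ` S" using mat.subspace_scale[OF S] s by (metis imageI)
  qed
  \<comment> \<open>If the row \<open>act s f\<close> is zero, then \<open>f\<close> vanishes on the
    range of \<open>s\<close>, hence at \<open>F s\<close>.\<close>
  have "axis None 1 \<notin> r ` S"
  proof
    assume "axis None 1 \<in> r ` S"
    then obtain s where s: "s \<in> S" "r s = axis None 1" by auto
    have "act s f $ j = 0" for j
      using arg_cong[OF s(2), of "\<lambda>v. v $ Some j"] by (simp add: r_def axis_def)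
    then have "act s f = 0" by (simp add: vec_eq_iff)
    moreover obtain u where "F s = s *v u"
      using F(2) s(1) by (auto simp: range_compatible_def)
    ultimately have "dot f (F s) = 0" by (simp add: eq_dot)
    then show False
      using arg_cong[OF s(2), of "\<lambda>v. v $ None"] by (simp add: r_def axis_def)
  qed
  then have "axis None 1 \<notin> vec.span (r ` S)" using sub by (simp add: vec.span_eq_iff[THEN iffD2])
  then obtain c where "\<And>g. g \<in> vec.span (r ` S) \<Longrightarrow> dot g c = 0" and c1: "dot (axis None 1) c = 1"
    by (rule dot_separation) blast
  then have c: "dot (r s) c = 0" if "s \<in> S" for s using that by (auto intro: vec.span_base)
  have dot_opt: "dot g c = g $ None * c $ None + dot (\<chi> j. g $ Some j) (\<chi> j. c $ Some j)" for g
    unfolding dot_def UNIV_option_conv by (subst sum.insert) (auto simp: sum.reindex)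
  have "c $ None = 1" using c1 by (simp add: dot_opt axis_def) (simp add: dot_def)
  \<comment> \<open>As \<open>c\<close> annihilates the graph and has coordinate 1 at
    \<open>None\<close>, its other coordinates, negated, represent the functional.\<close>
  have "dot f (F s) = dot f (s *v (- (\<chi> j. c $ Some j)))" if "s \<in> S" for s
  proof -
    have "dot f (F s) + dot (act s f) (\<chi> j. c $ Some j) = 0"
      using c[OF that] \<open>c $ None = 1\<close> by (simp add: dot_opt r_def)
    moreover have "dot (act s f) (- (\<chi> j. c $ Some j)) = - dot (act s f) (\<chi> j. c $ Some j)"
      by (simp add: dot_def sum_negf)
    ultimately show ?thesis unfolding eq_dot by (metis eq_neg_iff_add_eq_0)
  qed
  then show ?thesis by blast
qed

theorem theorem1p2:
  fixes S :: "('a::field ^ 'p ^ 'n) set"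
    and F :: "'a ^ 'p ^ 'n \<Rightarrow> 'a ^ 'n"
  assumes "CARD('p) \<ge> 2"
    and "module.subspace (mat_scale :: 'a \<Rightarrow> 'a^'p^'n \<Rightarrow> 'a^'p^'n) S"
    and "mat_codim S \<le> d_bound CARD('n) TYPE('a)"
    and "linear_on_mat S F"
    and "range_compatible S F"
  shows "local_map S F"
proof -
  let ?T = "{t. \<forall>s\<in>S. pairing t s = 0}"
  obtain x where x: "\<And>f s. s \<in> S \<Longrightarrow> dot f (F s) = dot f (s *v x f)"
    using range_functional[OF assms(2,4,5)] by metis
  \<comment> \<open>This value is linear in \<open>f\<close>, which yields linearity of the tensors
    modulo \<open>?T\<close>.\<close>
  have pt: "pairing (tens f (x f)) s = dot f (F s)" if "s \<in> S" for f s
    using x[OF that] by (simp add: pairing_tens)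
  have fam: "rc_family UNIV ?T x"
  proof
    show "mat.subspace ?T" by (auto simp: mat.subspace_def pairing_simps)
    show "act t b = 0" if "t \<in> ?T" "\<And>f. f \<in> UNIV \<Longrightarrow> dot f b = 0" for t and b :: "'a^'n"
    proof -
      have "b $ i = 0" for i
        using that(2)[of "axis i 1"]
        by (simp add: dot_def axis_def if_distrib[where f="\<lambda>x. x * _"] cong: if_cong)
      then have "b = 0" by (simp add: vec_eq_iff)
      then show ?thesis by simp
    qed
  qed (auto simp: pairing_simps pt)
  have "int (mat.dim ?T) \<le> d_bound (vec.dim (UNIV :: ('a^'n) set)) TYPE('a)"
    using dim_annihilator[OF assms(2)] assms(3) by (simp add: vec.dim_UNIV card_cart_basis)
  then obtain w where w: "UNIV \<subseteq> rc_family.agree UNIV ?T x w"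
    using rc_family_local[OF fam] by blast
  have "F s = s *v w" if s: "s \<in> S" for s
  proof -
    have "dot f (F s) = dot f (s *v w)" for f
    proof -
      have "f \<in> rc_family.agree UNIV ?T x w" using w by blast
      then have "pairing (tens f (x f - w)) s = 0"
        using s by (simp add: rc_family.agree_def[OF fam])
      then show ?thesis by (simp add: tens_simps pairing_simps pairing_tens x[OF s])
    qed
    from this[of "axis _ 1"] show ?thesis
      by (simp add: vec_eq_iff dot_def axis_def if_distrib[where f="\<lambda>x. x * _"] cong: if_cong)
  qed
  then show ?thesis by (auto simp: local_map_def)
qed

end
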